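(* For every $x,y\in\Omega$ and $0\le t\le1$, $$\gamma^{\mathrm{cv}}_{x,y}(t)=\Phi\bigl(T_x\,\#_{H,t}\,T_y\bigr).$$ In particular, $x\,\#_{\mathrm{cv}}\,y=\Phi(T_x\,\#_H\,T_y)$.
   Context: Let $V\subset \mathrm{Sym}(3,\mathbb{R})$ be the 5-dimensional space of real symmetric $3\times3$ matrices whose $(1,2)$ and $(2,1)$ entries are $0$, and let $\Omega\subset V$ be the open cone of positive definite matrices in $V$. Let $H$ be the group of real lower triangular $3\times 3$ matrices with positive diagonal entries and zero $(2,1)$ entry. The map $\Phi:H\to\Omega$, $\Phi(T)=TT^{\top}$, is a diffeomorphism; for $x\in\Omega$, $T_x:=\Phi^{-1}(x)\in H$ is the lower Cholesky factor of $x$. For $T\in H$ and $t\in\mathbb{R}$, $T^t:=\exp(t\log T)\in H$, where $\log$ is the principal matrix logarithm. The Cholesky-Vinberg path is $\gamma^{\mathrm{cv}}_{x,y}(t):=\Phi\bigl(T_x(T_x^{-1}T_y)^t\bigr)$, $0\le t\le1$, and $x\,\#_{\mathrm{cv}}\,y:=\gamma^{\mathrm{cv}}_{x,y}(1/2)$. For $A,B\in H$ and $0\le t\le1$, the weighted geometric mean on $H$ is $A\,\#_{H,t}\,B:=A^{1/2}\bigl(A^{-1/2}BA^{-1/2}\bigr)^tA^{1/2}$ (principal powers in $H$), and $A\,\#_H\,B:=A\,\#_{H,1/2}\,B$. *)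

theory Defs
  imports "HOL-Analysis.Analysis"
begin

section \<open>Matrix exponential, principal logarithm and real powers\<close>

text \<open>On \<open>real ^ 'n ^ 'n\<close> the library's \<open>*\<close>, \<open>^\<close> and \<open>1\<close> are componentwise (and \<open>exp\<close> is not
  available), so the power series is written out with the matrix product \<open>**\<close> and \<open>mat 1\<close>.\<close>

definition mat_exp :: "real^'n^'n \<Rightarrow> real^'n^'n" where
  "mat_exp A = (\<Sum>k. (1 / fact k) *\<^sub>R (((**) A) ^^ k) (mat 1))"

definition mat_eigenvalue :: "real^'n^'n \<Rightarrow> complex \<Rightarrow> bool" where
  "mat_eigenvalue A l \<longleftrightarrow>
     (\<exists>v :: complex^'n. v \<noteq> 0 \<and> map_matrix complex_of_real A *v v = l *s v)"

text \<open>The principal logarithm is the unique logarithm all of whose (complex) eigenvalues lie in the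
  open strip \<open>\<bar>Im z\<bar> < pi\<close>. It exists, and is real, precisely for the real matrices without eigenvalues
  in \<open>(-\<infinity>, 0]\<close>; on all other matrices the value is arbitrary.\<close>

definition mat_log :: "real^'n^'n \<Rightarrow> real^'n^'n" where
  "mat_log A = (THE X. mat_exp X = A \<and> (\<forall>l. mat_eigenvalue X l \<longrightarrow> \<bar>Im l\<bar> < pi))"

definition mat_rpow :: "real^'n^'n \<Rightarrow> real \<Rightarrow> real^'n^'n" where
  "mat_rpow A t = mat_exp (t *\<^sub>R mat_log A)"

section \<open>The Vinberg cone and its Cholesky group\<close>

definition VV :: "(real^3^3) set" where
  "VV = {x. transpose x = x \<and> x $ 1 $ 2 = 0 \<and> x $ 2 $ 1 = 0}"

definition Omega :: "(real^3^3) set" where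
  "Omega = {x \<in> VV. \<forall>v. v \<noteq> 0 \<longrightarrow> v \<bullet> (x *v v) > 0}"

text \<open>Entries are listed explicitly because \<open>3 = 0\<close> in the index type \<open>3\<close>, so that its order is not
  \<open>1 < 2 < 3\<close>.\<close>

definition HH :: "(real^3^3) set" where
  "HH = {T. T $ 1 $ 2 = 0 \<and> T $ 1 $ 3 = 0 \<and> T $ 2 $ 3 = 0 \<and> T $ 2 $ 1 = 0 \<and>
            T $ 1 $ 1 > 0 \<and> T $ 2 $ 2 > 0 \<and> T $ 3 $ 3 > 0}"

definition Phi :: "real^3^3 \<Rightarrow> real^3^3" where
  "Phi T = T ** transpose T"

definition chol :: "real^3^3 \<Rightarrow> real^3^3" where
  "chol x = inv_into HH Phi x"

section \<open>Cholesky-Vinberg path and geometric means\<close>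

definition cv_path :: "real^3^3 \<Rightarrow> real^3^3 \<Rightarrow> real \<Rightarrow> real^3^3" where
  "cv_path x y t = Phi (chol x ** mat_rpow (matrix_inv (chol x) ** chol y) t)"

definition cv_mean :: "real^3^3 \<Rightarrow> real^3^3 \<Rightarrow> real^3^3" where
  "cv_mean x y = cv_path x y (1/2)"

definition H_wmean :: "real^3^3 \<Rightarrow> real \<Rightarrow> real^3^3 \<Rightarrow> real^3^3" where
  "H_wmean A t B =
     mat_rpow A (1/2) ** mat_rpow (mat_rpow A (-1/2) ** B ** mat_rpow A (-1/2)) t ** mat_rpow A (1/2)"

definition H_mean :: "real^3^3 \<Rightarrow> real^3^3 \<Rightarrow> real^3^3" where
  "H_mean A B = H_wmean A (1/2) B"

end

theory Submission
  imports Defs "HOL-Computational_Algebra.Fundamental_Theorem_Algebra"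
begin

text \<open>By similarity, \<open>A #\<^bsub>H,t\<^esub> B = A (A\<^sup>-\<^sup>1 B)\<^sup>t\<close>, because \<open>A\<^sup>-\<^sup>1 B\<close> is the
  conjugate of \<open>A\<^bsup>-1/2\<^esup> B A\<^bsup>-1/2\<^esup>\<close> by \<open>A\<^bsup>1/2\<^esup>\<close>. Powers commute with conjugation once the
  principal logarithm of an element of \<open>H\<close> is known to be unique among all real matrices. If the
  spectrum of \<open>X\<close> lies in \<open>\<bar>Im z\<bar> < pi\<close>, every eigenvector of \<open>exp X\<close> for \<open>e\<^sup>c\<close>, with \<open>c\<close> real,
  is an eigenvector of \<open>X\<close> for \<open>c\<close>. An element of \<open>H\<close> has two left eigenvectors and one right
  eigenvector among the unit vectors, so its logarithm lies in the Lie algebra of \<open>H\<close>, where the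
  exponential is explicit and injective.\<close>

section \<open>Eigenvectors of a commuting matrix\<close>

text \<open>The iterates of \<open>u\<close> up to the real dimension of the space are one too many
  to be independent, so a real relation exists; its coefficients form \<open>p\<close>.\<close>

lemma matrix_cyclic_annihilator:
  fixes A :: "complex^'n^'n" and u :: "complex^'n"
  obtains p :: "complex poly" where "p \<noteq> 0"
    "(\<Sum>i\<le>degree p. coeff p i *s (((*v) A) ^^ i) u) = 0"
proof -
  let ?f = "\<lambda>i. (((*v) A) ^^ i) u" and ?N = "DIM(complex^'n)"
  obtain N and c :: "nat \<Rightarrow> complex" where c: "\<exists>i\<le>N. c i \<noteq> 0" "(\<Sum>i\<le>N. c i *s ?f i) = 0"
  proof (cases "inj_on ?f {..?N}")
    case True
    have "dependent (?f ` {..?N})"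
      using card_image[OF True] by (intro dependent_biggerset) (simp only: card_atMost lessI)
    then obtain w where w: "\<exists>v\<in>?f ` {..?N}. w v \<noteq> 0" "(\<Sum>v\<in>?f ` {..?N}. w v *\<^sub>R v) = 0"
      by (subst (asm) real_vector.dependent_finite) auto
    show ?thesis
    proof (rule that[of ?N "\<lambda>i. of_real (w (?f i))"])
      show "\<exists>i\<le>?N. complex_of_real (w (?f i)) \<noteq> 0"
        using w(1) by auto
      have "(\<Sum>i\<le>?N. complex_of_real (w (?f i)) *s ?f i) = (\<Sum>i\<le>?N. w (?f i) *\<^sub>R ?f i)"
        by (intro sum.cong refl) (simp add: vec_eq_iff scaleR_conv_of_real[where 'a = complex])
      also have "\<dots> = (\<Sum>v\<in>?f ` {..?N}. w v *\<^sub>R v)"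
        using sum.reindex[OF True, of "\<lambda>v. w v *\<^sub>R v"] by (simp only: o_def)
      finally show "(\<Sum>i\<le>?N. complex_of_real (w (?f i)) *s ?f i) = 0"
        using w(2) by simp
    qed
  next
    case False
    then obtain i j where ij: "i < j" "?f i = ?f j"
      by (auto simp: inj_on_def) (metis linorder_neqE_nat)
    \<comment> \<open>A repeated iterate shrinks the set to be counted, but it is itself a relation,
      with polynomial x^i - x^j.\<close>
    let ?c = "\<lambda>k. if k = i then 1 else if k = j then -1 else (0::complex)"
    have "(\<Sum>k\<le>j. ?c k *s ?f k) = (\<Sum>k\<in>{i,j}. ?c k *s ?f k)"
      using ij by (intro sum.mono_neutral_right) auto
    also have "\<dots> = 0"
      using ij by simp
    finally show ?thesis
      using ij by (intro that[of j ?c]) auto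
  qed
  define p where "p = (\<Sum>i\<le>N. monom (c i) i)"
  have coeff: "coeff p i = (if i \<le> N then c i else 0)" for i
    by (simp add: p_def coeff_sum if_distrib[of "\<lambda>x. x i"] cong: if_cong)
  have "p \<noteq> 0"
    using c(1) coeff by (metis coeff_0)
  moreover have "degree p \<le> N"
    by (intro degree_le) (simp add: coeff)
  then have "(\<Sum>i\<le>degree p. coeff p i *s ?f i) = (\<Sum>i\<le>N. c i *s ?f i)"
    by (intro sum.mono_neutral_cong_left)
      (use coeff coeff_eq_0[of p] in \<open>auto simp: not_le, metis\<close>)
  ultimately show ?thesis
    using c(2) that by simp
qed

text \<open>The \<open>m\<close>-eigenspace of \<open>B\<close> is invariant under \<open>A\<close>.
  By \<open>eig\<close> the only possible eigenvalue of \<open>A\<close> there is \<open>c\<close>,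
  and \<open>jordan\<close> excludes Jordan chains of length two, so \<open>A\<close> acts on it as
  the scalar \<open>c\<close>.\<close>

lemma eigenvector_of_commuting_matrix:
  fixes A B :: "complex^'n^'n"
  assumes comm: "A ** B = B ** A"
    and eig: "\<And>l v. v \<noteq> 0 \<Longrightarrow> A *v v = l *s v \<Longrightarrow> B *v v = m *s v \<Longrightarrow> l = c"
    and jordan: "\<And>v z. A *v v = c *s v + z \<Longrightarrow> A *v z = c *s z \<Longrightarrow> B *v v = m *s v \<Longrightarrow> z = 0"
    and u: "B *v u = m *s u"
  shows "A *v u = c *s u"
proof -
  let ?f = "\<lambda>i u. (((*v) A) ^^ i) u"
  have B: "B *v (A *v v) = m *s (A *v v)" if "B *v v = m *s v" for v
    by (metis comm matrix_vector_mul_assoc vector_scalar_commute that)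
  have lin: "?f i (v - l *s w) = ?f i v - l *s ?f i w" for i l v w
    by (induction i) (simp_all add: matrix_vector_mult_diff_distrib vector_scalar_commute)
  \<comment> \<open>Induction on the degree of a polynomial annihilating \<open>u\<close>. The
    vector must vary too: removing a root \<open>l\<close> replaces \<open>u\<close> by (A -
    l)u.\<close>
  have main: "A *v u = c *s u"
    if "p \<noteq> 0" "(\<Sum>i\<le>degree p. coeff p i *s ?f i u) = 0" "B *v u = m *s u" for p u
    using that
  proof (induction "degree p" arbitrary: p u)
    case 0
    then obtain a where "p = [:a:]" "a \<noteq> 0"
      by (metis degree_eq_zeroE pCons_0_0)
    with 0 have "u = 0"
      by (simp add: vec_eq_iff)
    then show ?case
      by simp
  next
    case (Suc n)
    obtain l where "poly p l = 0"
      using Suc.hyps(2) fundamental_theorem_of_algebra[of p] constant_degree[of p] by auto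
    then obtain q where q: "p = [:-l, 1:] * q"
      by (auto simp: poly_eq_0_iff_dvd)
    with Suc.prems have "q \<noteq> 0"
      by auto
    then have deg: "degree q = n"
      using Suc.hyps(2) q degree_mult_eq[of "[:-l,1:]" q] by simp
    define v where "v = A *v u - l *s u"
    \<comment> \<open>With p = (x - l)q this computes p(A)u = q(A)(A - l)u, so \<open>q\<close>
      annihilates \<open>v\<close>.\<close>
    have "(\<Sum>i\<le>Suc n. coeff p i *s ?f i u) =
        (\<Sum>i\<le>Suc n. coeff (pCons 0 q) i *s ?f i u) - l *s (\<Sum>i\<le>Suc n. coeff q i *s ?f i u)"
      unfolding q vec.scale_sum_right
      by (simp add: sum_subtractf[symmetric] algebra_simps vec.scale_left_diff_distrib del: sum.atMost_Suc)
    also have "(\<Sum>i\<le>Suc n. coeff (pCons 0 q) i *s ?f i u) = (\<Sum>i\<le>n. coeff q i *s ?f i (A *v u))"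
      by (subst sum.atMost_Suc_shift) (simp add: funpow_swap1)
    also have "(\<Sum>i\<le>Suc n. coeff q i *s ?f i u) = (\<Sum>i\<le>n. coeff q i *s ?f i u)"
      by (simp add: deg coeff_eq_0)
    also have "(\<Sum>i\<le>n. coeff q i *s ?f i (A *v u)) - l *s \<dots> = (\<Sum>i\<le>n. coeff q i *s ?f i v)"
      unfolding v_def lin vec.scale_sum_right
      by (simp add: sum_subtractf[symmetric] vec.scale_right_diff_distrib mult.commute)
    finally have "(\<Sum>i\<le>degree q. coeff q i *s ?f i v) = 0"
      using Suc.prems(2) Suc.hyps(2) deg by simp
    moreover have Bv: "B *v v = m *s v"
      using B Suc.prems(3)
      by (simp add: v_def matrix_vector_mult_diff_distrib vector_scalar_commute
          vec.scale_right_diff_distrib mult.commute)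
    ultimately have Av: "A *v v = c *s v"
      using Suc.hyps(1)[of q v] \<open>q \<noteq> 0\<close> deg by blast
    show ?case
    proof (cases "l = c")
      case True
      have "v = 0"
        by (rule jordan[of u]) (use Av Suc.prems(3) True in \<open>auto simp: v_def\<close>)
      then show ?thesis
        using True by (simp add: v_def)
    next
      case False
      \<comment> \<open>Interchanging the commuting factors in (A - c)(A - l)u = 0 shows that (A -
        c)u is killed by A - l.\<close>
      define w where "w = A *v u - c *s u"
      have "A *v w = l *s w"
        using Av unfolding v_def w_def
        by (simp add: matrix_vector_mult_diff_distrib vector_scalar_commute
            vec.scale_right_diff_distrib algebra_simps)
      moreover have "B *v w = m *s w"
        using B Suc.prems(3)
        by (simp add: w_def matrix_vector_mult_diff_distrib vector_scalar_commute
            vec.scale_right_diff_distrib mult.commute)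
      ultimately have "w = 0"
        using eig[of w l] False by auto
      then show ?thesis
        by (simp add: w_def)
    qed
  qed
  obtain p where "p \<noteq> 0" "(\<Sum>i\<le>degree p. coeff p i *s ?f i u) = 0"
    using matrix_cyclic_annihilator .
  then show ?thesis
    using main u by blast
qed

section \<open>The matrix exponential\<close>

text \<open>Boundedness of a bilinear map in finite dimension; submultiplicativity up to a constant
  is enough to dominate the exponential series.\<close>

lemma norm_matrix_mult_le:
  obtains K where "K > 0" "\<And>(A :: real^'m^'n) (B :: real^'k^'m). norm (A ** B) \<le> norm A * norm B * K"
proof -
  have "bilinear (\<lambda>(A :: real^'m^'n) (B :: real^'k^'m). A ** B)"
    by (auto simp: bilinear_def linear_iff vec_eq_iff matrix_matrix_mult_def
        sum_distrib_left sum.distrib algebra_simps)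
  then have "bounded_bilinear (\<lambda>(A :: real^'m^'n) (B :: real^'k^'m). A ** B)"
    by (simp add: bilinear_conv_bounded_bilinear)
  then show ?thesis
    using bounded_bilinear.pos_bounded that by blast
qed

lemma mat_exp_sums:
  fixes A :: "real^'n^'n"
  shows "(\<lambda>k. (1 / fact k) *\<^sub>R (((**) A) ^^ k) (mat 1)) sums mat_exp A"
proof -
  obtain K where K: "K > 0" "\<And>(A :: real^'n^'n) (B :: real^'n^'n). norm (A ** B) \<le> norm A * norm B * K"
    using norm_matrix_mult_le by metis
  have pow: "norm ((((**) A) ^^ k) (mat 1)) \<le> norm (mat 1 :: real^'n^'n) * (norm A * K) ^ k" for k
  proof (induction k)
    case (Suc k)
    have "norm ((((**) A) ^^ Suc k) (mat 1)) \<le> norm A * norm ((((**) A) ^^ k) (mat 1)) * K"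
      using K(2) by simp
    also have "\<dots> \<le> norm A * (norm (mat 1 :: real^'n^'n) * (norm A * K) ^ k) * K"
      using K(1) Suc by (intro mult_left_mono mult_right_mono) auto
    finally show ?case
      by (simp add: mult_ac)
  qed simp
  have "summable (\<lambda>k. norm (mat 1 :: real^'n^'n) * (inverse (fact k) * (norm A * K) ^ k))"
    by (intro summable_mult summable_exp)
  then have "summable (\<lambda>k. (1 / fact k) *\<^sub>R (((**) A) ^^ k) (mat 1))"
    by (rule summable_comparison_test') (use pow in \<open>auto simp: divide_simps mult_ac\<close>)
  then show ?thesis
    unfolding mat_exp_def by (rule summable_sums)
qed

lemma mat_exp_eqI: "(\<lambda>k. (1 / fact k) *\<^sub>R (((**) A) ^^ k) (mat 1)) sums B \<Longrightarrow> mat_exp A = B"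
  using mat_exp_sums sums_unique2 by blast

lemma matrix_funpow_commute:
  fixes A :: "real^'n^'n"
  shows "(((**) A) ^^ k) (mat 1) ** A = A ** (((**) A) ^^ k) (mat 1)"
  by (induction k) (simp_all add: matrix_mul_assoc[symmetric])

lemma bounded_linear_matrix_mult_left: "bounded_linear (\<lambda>X :: real^'n^'m. (A :: real^'m^'k) ** X)"
  and bounded_linear_matrix_mult_right: "bounded_linear (\<lambda>X :: real^'m^'k. X ** (B :: real^'n^'m))"
  by (auto simp: linear_conv_bounded_linear[symmetric] linear_iff vec_eq_iff
      matrix_matrix_mult_def sum_distrib_left algebra_simps sum.distrib)

lemma mat_exp_commute: "A ** mat_exp A = mat_exp A ** A"
proof -
  have "(\<lambda>k. A ** ((1 / fact k) *\<^sub>R (((**) A) ^^ k) (mat 1))) sums (A ** mat_exp A)"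
    by (intro bounded_linear.sums[OF bounded_linear_matrix_mult_left] mat_exp_sums)
  moreover have "(\<lambda>k. ((1 / fact k) *\<^sub>R (((**) A) ^^ k) (mat 1)) ** A) sums (mat_exp A ** A)"
    by (intro bounded_linear.sums[OF bounded_linear_matrix_mult_right] mat_exp_sums)
  moreover have "A ** ((1 / fact k) *\<^sub>R (((**) A) ^^ k) (mat 1))
      = ((1 / fact k) *\<^sub>R (((**) A) ^^ k) (mat 1)) ** A" for k
    using matrix_funpow_commute[of k A]
    by (simp add: linear_cmul[OF bounded_linear.linear[OF bounded_linear_matrix_mult_left]]
      linear_cmul[OF bounded_linear.linear[OF bounded_linear_matrix_mult_right]])
  ultimately show ?thesis
    using sums_unique2 by simp
qed

lemma mat_exp_conj:
  fixes A P Q :: "real^'n^'n"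
  assumes "P ** Q = mat 1"
  shows "mat_exp (Q ** A ** P) = Q ** mat_exp A ** P"
proof (rule mat_exp_eqI)
  have QP: "Q ** P = mat 1"
    using assms(1) by (simp add: matrix_left_right_inverse)
  have pow: "(((**) (Q ** A ** P)) ^^ k) (mat 1) = Q ** (((**) A) ^^ k) (mat 1) ** P" for k
  proof (induction k)
    case (Suc k)
    then have "(((**) (Q ** A ** P)) ^^ Suc k) (mat 1) = Q ** A ** (P ** Q) ** (((**) A) ^^ k) (mat 1) ** P"
      by (simp add: matrix_mul_assoc)
    then show ?case
      by (simp add: assms matrix_mul_assoc)
  qed (simp add: QP)
  have "(\<lambda>k. Q ** ((1 / fact k) *\<^sub>R (((**) A) ^^ k) (mat 1)) ** P) sums (Q ** mat_exp A ** P)"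
    by (intro bounded_linear.sums[OF bounded_linear_matrix_mult_left]
        bounded_linear.sums[OF bounded_linear_matrix_mult_right] mat_exp_sums)
  then show "(\<lambda>k. (1 / fact k) *\<^sub>R (((**) (Q ** A ** P)) ^^ k) (mat 1)) sums (Q ** mat_exp A ** P)"
    by (simp add: pow linear_cmul[OF bounded_linear.linear[OF bounded_linear_matrix_mult_left]]
      linear_cmul[OF bounded_linear.linear[OF bounded_linear_matrix_mult_right]])
qed

text \<open>Lets results on eigenvectors be applied to left eigenvectors.\<close>

lemma mat_exp_transpose: "mat_exp (transpose A) = transpose (mat_exp A)"
proof (rule mat_exp_eqI)
  have pow: "(((**) (transpose A)) ^^ k) (mat 1) = transpose ((((**) A) ^^ k) (mat 1))" for k
    by (induction k) (simp_all add: matrix_transpose_mul[symmetric] matrix_funpow_commute)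
  have "bounded_linear (transpose :: real^'n^'n \<Rightarrow> real^'n^'n)"
    by (simp add: linear_conv_bounded_linear[symmetric] linear_iff transpose_def vec_eq_iff)
  from bounded_linear.sums[OF this mat_exp_sums[of A]]
  show "(\<lambda>k. (1 / fact k) *\<^sub>R (((**) (transpose A)) ^^ k) (mat 1)) sums transpose (mat_exp A)"
    by (simp add: pow transpose_scalar)
qed

section \<open>Complexification, and the exponential on Jordan chains\<close>

abbreviation cmat :: "real^'n^'m \<Rightarrow> complex^'n^'m" where
  "cmat \<equiv> map_matrix complex_of_real"

lemma cmat_mult: "cmat (A ** B) = cmat A ** cmat B"
  by (simp add: vec_eq_iff matrix_matrix_mult_def)

lemma cmat_one: "cmat (mat 1) = mat 1"
  by (simp add: vec_eq_iff mat_def)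

lemma cmat_mat_exp_sums:
  fixes A :: "real^'n^'n"
  shows "(\<lambda>k. complex_of_real (1 / fact k) *s (((*v) (cmat A)) ^^ k) v) sums (cmat (mat_exp A) *v v)"
proof -
  have pow: "cmat ((((**) A) ^^ k) (mat 1)) *v v = (((*v) (cmat A)) ^^ k) v" for k
    by (induction k) (simp_all add: cmat_mult cmat_one matrix_vector_mul_assoc[symmetric])
  have "bounded_linear (\<lambda>A. cmat A *v v)"
    by (auto simp: linear_conv_bounded_linear[symmetric] linear_iff vec_eq_iff
        matrix_vector_mult_def sum.distrib scaleR_conv_of_real[where 'a = complex]
        sum_distrib_left algebra_simps)
  from bounded_linear.sums[OF this mat_exp_sums[of A]]
  have "(\<lambda>k. cmat ((1 / fact k) *\<^sub>R (((**) A) ^^ k) (mat 1)) *v v) sums (cmat (mat_exp A) *v v)" .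
  moreover have "cmat (r *\<^sub>R X) *v v = complex_of_real r *s (cmat X *v v)"
    for r and X :: "real^'n^'n"
    by (simp add: vec_eq_iff matrix_vector_mult_def sum_distrib_left algebra_simps)
  ultimately show ?thesis
    by (simp only: flip: pow)
qed

lemma exp_series_sums:
  fixes c :: "'a :: {banach, real_normed_field}"
  shows "(\<lambda>k. (1 / fact k) * c ^ k) sums exp c"
  using exp_converges[of c] by (simp add: scaleR_conv_of_real divide_inverse)

text \<open>The termwise derivative of the exponential series. At k = 0 the truncated exponent is
  harmless, since the factor k vanishes.\<close>

lemma exp_deriv_series_sums:
  fixes c :: "'a :: {banach, real_normed_field}"
  shows "(\<lambda>k. (1 / fact k) * (of_nat k * c ^ (k - 1))) sums exp c"
proof -
  have "(1 / fact (Suc k)) * (of_nat (Suc k) * c ^ k) = (1 / fact k) * c ^ k" for k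
    by (simp add: divide_simps del: of_nat_Suc)
  then have "(\<lambda>k. (1 / fact (Suc k)) * (of_nat (Suc k) * c ^ (Suc k - 1))) sums exp c"
    using exp_series_sums by simp
  then show ?thesis
    by (subst (asm) sums_Suc_iff) simp
qed

lemma bounded_linear_scaleC_left: "bounded_linear (\<lambda>c. c *s (v :: complex^'n))"
  by (simp add: linear_conv_bounded_linear[symmetric] linear_iff vec_eq_iff algebra_simps)

text \<open>On the span of the chain, N = A - c satisfies Nv = z and Nz = 0, so exp(A)v = e^c (v +
  Nv). The case z = 0 covers eigenvectors.\<close>

lemma cmat_mat_exp_jordan:
  assumes v: "cmat A *v v = c *s v + z" and z: "cmat A *v z = c *s z"
  shows "cmat (mat_exp A) *v v = exp c *s v + exp c *s z"
proof -
  have pow: "(((*v) (cmat A)) ^^ k) v = c ^ k *s v + (of_nat k * c ^ (k - 1)) *s z" for k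
  proof (induction k)
    case (Suc k)
    have "(((*v) (cmat A)) ^^ Suc k) v = c ^ k *s (c *s v + z) + (of_nat k * c ^ (k - 1)) *s (c *s z)"
      by (simp add: Suc matrix_vector_right_distrib vector_scalar_commute v z)
    then show ?case
      by (cases k) (simp_all add: vec_eq_iff algebra_simps)
  qed simp
  have "(\<lambda>k. ((1 / fact k) * c ^ k) *s v
      + ((1 / fact k) * (of_nat k * c ^ (k - 1))) *s z) sums (exp c *s v + exp c *s z)"
    by (intro sums_add bounded_linear.sums[OF bounded_linear_scaleC_left]
        exp_series_sums exp_deriv_series_sums)
  moreover have "(\<lambda>k. ((1 / fact k) * c ^ k) *s v
      + ((1 / fact k) * (of_nat k * c ^ (k - 1))) *s z) sums (cmat (mat_exp A) *v v)"
    using cmat_mat_exp_sums[of A v] by (simp add: pow vector_add_ldistrib)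
  ultimately show ?thesis
    using sums_unique2 by blast
qed

lemma exp_eq_exp_of_real_strip:
  assumes "exp l = exp (complex_of_real c)" "\<bar>Im l\<bar> < pi"
  shows "l = of_real c"
  by (rule exp_complex_eqI) (use assms in auto)

text \<open>\<open>X\<close> commutes with its exponential. On the e^c-eigenspace of the latter, the
  strip forces every eigenvalue of \<open>X\<close> to be \<open>c\<close>, and a Jordan chain would
  add a nonzero e^c z.\<close>

lemma mat_exp_eigenvector_imp:
  assumes strip: "\<And>l. mat_eigenvalue X l \<Longrightarrow> \<bar>Im l\<bar> < pi"
    and v: "mat_exp X *v v = exp c *\<^sub>R v"
  shows "X *v v = c *\<^sub>R v"
proof -
  define u :: "complex^'a" where "u = (\<chi> i. of_real (v $ i))"
  have cmat_u: "cmat M *v u = (\<chi> i. of_real ((M *v v) $ i))" for M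
    by (simp add: u_def vec_eq_iff matrix_vector_mult_def)
  have "cmat X *v u = complex_of_real c *s u"
  proof (rule eigenvector_of_commuting_matrix[where B = "cmat (mat_exp X)" and m = "exp (of_real c)"])
    show "cmat X ** cmat (mat_exp X) = cmat (mat_exp X) ** cmat X"
      by (metis cmat_mult mat_exp_commute)
    show "cmat (mat_exp X) *v u = exp (complex_of_real c) *s u"
      by (simp add: cmat_u v) (simp add: u_def vec_eq_iff exp_of_real)
  next
    fix l w
    assume w: "w \<noteq> 0" "cmat X *v w = l *s w" "cmat (mat_exp X) *v w = exp (complex_of_real c) *s w"
    have "exp l *s w = exp (complex_of_real c) *s w"
      using cmat_mat_exp_jordan[of X w l 0] w by simp
    then have "exp l = exp (complex_of_real c)"
      using w(1) vec.scale_right_imp_eq by blast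
    moreover have "mat_eigenvalue X l"
      using w by (auto simp: mat_eigenvalue_def)
    ultimately show "l = of_real c"
      using strip exp_eq_exp_of_real_strip by blast
  next
    fix w z
    assume "cmat X *v w = complex_of_real c *s w + z" "cmat X *v z = complex_of_real c *s z"
      "cmat (mat_exp X) *v w = exp (complex_of_real c) *s w"
    then have "exp (complex_of_real c) *s z = 0"
      using cmat_mat_exp_jordan[of X w "of_real c" z] by simp
    then show "z = 0"
      by simp
  qed
  then show ?thesis
    by (simp add: cmat_u) (simp add: u_def vec_eq_iff flip: of_real_mult)
qed

section \<open>Eigenvalues under transposition and conjugation\<close>

lemma mat_eigenvalue_iff_det:
  "mat_eigenvalue (A :: real^'n^'n) l \<longleftrightarrow> det (cmat A - mat l) = 0"
proof -
  have "mat l *v v = l *s v" for v :: "complex^'n"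
    by (simp add: vec_eq_iff matrix_vector_mult_def mat_def if_distrib[of "\<lambda>x. x * _"] cong: if_cong)
  then have "mat_eigenvalue A l \<longleftrightarrow> \<not> (\<forall>v. (cmat A - mat l) *v v = 0 \<longrightarrow> v = 0)"
    by (auto simp: mat_eigenvalue_def matrix_vector_mult_diff_rdistrib)
  also have "\<dots> \<longleftrightarrow> \<not> invertible (cmat A - mat l)"
    using matrix_left_invertible_ker[of "cmat A - mat l"] by (simp add: invertible_left_inverse)
  finally show ?thesis
    by (simp add: invertible_det_nz)
qed

lemma mat_eigenvalue_transpose: "mat_eigenvalue (transpose A) l \<longleftrightarrow> mat_eigenvalue A l"
proof -
  have "cmat (transpose A) - mat l = transpose (cmat A - mat l)"
    by (auto simp: vec_eq_iff transpose_def mat_def)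
  then show ?thesis
    by (simp add: mat_eigenvalue_iff_det det_transpose)
qed

text \<open>If v is an eigenvector of the conjugate, then Pv is one of \<open>A\<close>; it is
  nonzero because \<open>Q\<close> maps it back to v.\<close>

lemma mat_eigenvalue_conj:
  fixes A P Q :: "real^'n^'n"
  assumes "P ** Q = mat 1" "mat_eigenvalue (Q ** A ** P) l"
  shows "mat_eigenvalue A l"
proof -
  obtain v where v: "v \<noteq> 0" "cmat (Q ** A ** P) *v v = l *s v"
    using assms(2) by (auto simp: mat_eigenvalue_def)
  have QP: "Q ** P = mat 1"
    using assms(1) by (simp add: matrix_left_right_inverse)
  have "cmat A *v (cmat P *v v) = cmat ((P ** Q) ** A ** P) *v v"
    by (simp add: assms cmat_mult matrix_vector_mul_assoc)
  also have "\<dots> = cmat P *v (cmat (Q ** A ** P) *v v)"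
    by (simp only: cmat_mult matrix_vector_mul_assoc matrix_mul_assoc)
  also have "\<dots> = l *s (cmat P *v v)"
    by (simp add: v vector_scalar_commute)
  finally have "cmat A *v (cmat P *v v) = l *s (cmat P *v v)" .
  moreover have "cmat Q *v (cmat P *v v) = v"
    by (metis QP cmat_mult cmat_one matrix_vector_mul_assoc matrix_vector_mul_lid)
  then have "cmat P *v v \<noteq> 0"
    using v(1) by auto
  ultimately show ?thesis
    by (auto simp: mat_eigenvalue_def)
qed

section \<open>Exponential and logarithm on the Cholesky group\<close>

text \<open>A normal form for both the Lie algebra of H (arbitrary parameters) and H itself
  (positive diagonal); the family is closed under products and scaling.\<close>

definition low :: "real \<Rightarrow> real \<Rightarrow> real \<Rightarrow> real \<Rightarrow> real \<Rightarrow> real^3^3" where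
  "low p q w r s = vector [vector [p, 0, 0], vector [0, q, 0], vector [r, s, w]]"

lemma low_nth [simp]:
  "low p q w r s $ 1 $ 1 = p" "low p q w r s $ 1 $ 2 = 0" "low p q w r s $ 1 $ 3 = 0"
  "low p q w r s $ 2 $ 1 = 0" "low p q w r s $ 2 $ 2 = q" "low p q w r s $ 2 $ 3 = 0"
  "low p q w r s $ 3 $ 1 = r" "low p q w r s $ 3 $ 2 = s" "low p q w r s $ 3 $ 3 = w"
  by (simp_all add: low_def vector_3)

lemma low_eq_iff: "low p q w r s = low p' q' w' r' s' \<longleftrightarrow> p = p' \<and> q = q' \<and> w = w' \<and> r = r' \<and> s = s'"
  by (auto simp: vec_eq_iff forall_3)

lemma low_mult: "low p q w r s ** low p' q' w' r' s' =
    low (p * p') (q * q') (w * w') (r * p' + w * r') (s * q' + w * s')"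
  by (simp add: vec_eq_iff forall_3 matrix_matrix_mult_def sum_3)

lemma low_one: "mat 1 = low 1 1 1 0 0"
  by (simp add: vec_eq_iff forall_3 mat_def)

lemma scaleR_low: "t *\<^sub>R low p q w r s = low (t * p) (t * q) (t * w) (t * r) (t * s)"
  by (simp add: vec_eq_iff forall_3)

lemma HH_iff: "T \<in> HH \<longleftrightarrow> (\<exists>a b e c d. T = low a b e c d \<and> a > 0 \<and> b > 0 \<and> e > 0)"
proof
  assume "T \<in> HH"
  then have "T = low (T $ 1 $ 1) (T $ 2 $ 2) (T $ 3 $ 3) (T $ 3 $ 1) (T $ 3 $ 2)"
    by (simp add: HH_def vec_eq_iff forall_3)
  moreover have "T $ 1 $ 1 > 0 \<and> T $ 2 $ 2 > 0 \<and> T $ 3 $ 3 > 0"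
    using \<open>T \<in> HH\<close> by (simp add: HH_def)
  ultimately show "\<exists>a b e c d. T = low a b e c d \<and> a > 0 \<and> b > 0 \<and> e > 0"
    by blast
qed (auto simp: HH_def)

lemma low_in_HH_iff [simp]: "low a b e c d \<in> HH \<longleftrightarrow> a > 0 \<and> b > 0 \<and> e > 0"
  by (simp add: HH_def)

text \<open>The divided difference of \<open>exp\<close> is the off-diagonal factor in the exponential of a
  triangular matrix.\<close>

definition exp_dq :: "real \<Rightarrow> real \<Rightarrow> real" where
  "exp_dq p w = (if p = w then exp p else (exp p - exp w) / (p - w))"

text \<open>Rests on the injectivity of exp; it allows the off-diagonal entries of a logarithm to be
  solved for.\<close>

lemma exp_dq_nonzero: "exp_dq p w \<noteq> 0"
  by (simp add: exp_dq_def)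

text \<open>The off-diagonal part of \<open>exp (a L) exp (b L) = exp ((a + b) L)\<close>.\<close>

lemma exp_dq_add:
  "a * exp_dq (a * p) (a * w) * exp (b * p) + exp (a * w) * (b * exp_dq (b * p) (b * w)) =
    (a + b) * exp_dq ((a + b) * p) ((a + b) * w)"
proof (cases "p = w")
  case True
  then show ?thesis
    by (simp add: exp_dq_def algebra_simps exp_add)
next
  case False
  \<comment> \<open>The factor t cancels from the denominator t(p - w). At t = 0, where
    \<open>exp_dq\<close> takes its diagonal branch, both sides vanish. The numerators then
    telescope.\<close>
  then have *: "t * exp_dq (t * p) (t * w) = (exp (t * p) - exp (t * w)) / (p - w)" for t
    by (auto simp: exp_dq_def divide_simps) (simp_all add: algebra_simps)
  have "a * exp_dq (a * p) (a * w) * exp (b * p) + exp (a * w) * (b * exp_dq (b * p) (b * w)) =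
      ((exp (a * p) - exp (a * w)) * exp (b * p) + exp (a * w) * (exp (b * p) - exp (b * w))) / (p - w)"
    by (simp only: *) (simp add: add_divide_distrib)
  then show ?thesis
    by (simp only: *) (simp add: algebra_simps exp_add)
qed

text \<open>The divided difference of x^k, which is the off-diagonal factor in the k-th power of a
  triangular matrix. Both branches give 0 at k = 0.\<close>

definition pow_dq :: "nat \<Rightarrow> real \<Rightarrow> real \<Rightarrow> real" where
  "pow_dq k p w = (if p = w then k * p ^ (k - 1) else (p ^ k - w ^ k) / (p - w))"

lemma pow_dq_Suc: "pow_dq (Suc k) p w = p ^ k + w * pow_dq k p w"
  by (cases k) (auto simp: pow_dq_def divide_simps algebra_simps)

lemma pow_dq_sums: "(\<lambda>k. (1 / fact k) * pow_dq k p w) sums exp_dq p w"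
proof (cases "p = w")
  case True
  then show ?thesis
    using exp_deriv_series_sums[of w] by (simp add: pow_dq_def exp_dq_def)
next
  case False
  have "(\<lambda>k. ((1 / fact k) * p ^ k - (1 / fact k) * w ^ k) / (p - w)) sums ((exp p - exp w) / (p - w))"
    by (intro sums_divide sums_diff exp_series_sums)
  then show ?thesis
    using False by (simp add: pow_dq_def exp_dq_def diff_divide_distrib mult.commute)
qed

lemma sums_vecI: "(\<And>i. (\<lambda>k. f k $ i) sums (s $ i)) \<Longrightarrow> f sums s"
  unfolding sums_def by (auto intro: vec_tendstoI)

lemma mat_exp_low:
  "mat_exp (low p q w r s) = low (exp p) (exp q) (exp w) (r * exp_dq p w) (s * exp_dq q w)"
proof (rule mat_exp_eqI)
  have pow: "(((**) (low p q w r s)) ^^ k) (mat 1) =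
      low (p ^ k) (q ^ k) (w ^ k) (r * pow_dq k p w) (s * pow_dq k q w)" for k
  proof (induction k)
    case 0
    show ?case
      by (simp add: low_one pow_dq_def)
  next
    case (Suc k)
    then show ?case
      by (simp add: low_mult low_eq_iff pow_dq_Suc algebra_simps)
  qed
  have *: "(\<lambda>k. (1 / fact k) * (c * pow_dq k p w)) sums (c * exp_dq p w)" for c p w
    using sums_mult[OF pow_dq_sums[of p w], of c] by (simp add: mult_ac)
  have "\<forall>i j. (\<lambda>k. ((1 / fact k) *\<^sub>R low (p ^ k) (q ^ k) (w ^ k) (r * pow_dq k p w) (s * pow_dq k q w)) $ i $ j)
      sums (low (exp p) (exp q) (exp w) (r * exp_dq p w) (s * exp_dq q w) $ i $ j)"
    unfolding forall_3 scaleR_low low_nth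
    using exp_series_sums * by auto
  then show "(\<lambda>k. (1 / fact k) *\<^sub>R (((**) (low p q w r s)) ^^ k) (mat 1)) sums
      low (exp p) (exp q) (exp w) (r * exp_dq p w) (s * exp_dq q w)"
    unfolding pow by (intro sums_vecI) blast
qed

lemma mat_exp_scaleR_low_add:
  "mat_exp (a *\<^sub>R low p q w r s) ** mat_exp (b *\<^sub>R low p q w r s) =
    mat_exp ((a + b) *\<^sub>R low p q w r s)"
proof -
  have "a * r * exp_dq (a * p) (a * w) * exp (b * p) + exp (a * w) * (b * r * exp_dq (b * p) (b * w)) =
      (a + b) * r * exp_dq ((a + b) * p) ((a + b) * w)" for r p w
    using arg_cong[OF exp_dq_add[of a p w b], of "\<lambda>x. r * x"] by (simp add: algebra_simps)
  then show ?thesis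
    unfolding scaleR_low mat_exp_low low_mult low_eq_iff
    by (simp add: distrib_right exp_add)
qed

text \<open>The eigenvalues of a triangular matrix are its diagonal entries, here real; so every
  \<open>low\<close> matrix meets the strip condition of \<open>mat_log\<close>.\<close>

lemma mat_eigenvalue_low:
  assumes "mat_eigenvalue (low p q w r s) l"
  shows "Im l = 0"
proof -
  obtain v where v: "v \<noteq> 0" "cmat (low p q w r s) *v v = l *s v"
    using assms by (auto simp: mat_eigenvalue_def)
  have "of_real p * v $ 1 = l * v $ 1" "of_real q * v $ 2 = l * v $ 2"
    "of_real r * v $ 1 + of_real s * v $ 2 + of_real w * v $ 3 = l * v $ 3"
    using v(2) by (simp_all add: vec_eq_iff forall_3 matrix_vector_mult_def sum_3)
  moreover have "v $ 1 \<noteq> 0 \<or> v $ 2 \<noteq> 0 \<or> v $ 3 \<noteq> 0"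
    using v(1) by (auto simp: vec_eq_iff forall_3)
  ultimately have "l = of_real p \<or> l = of_real q \<or> l = of_real w"
    by auto
  then show ?thesis
    by auto
qed

lemma matrix_column_eigen:
  fixes X :: "real^'n^'n"
  shows "X *v axis j 1 = c *\<^sub>R axis j 1 \<longleftrightarrow> (\<forall>i. X $ i $ j = (if i = j then c else 0))"
proof -
  have "(c *\<^sub>R axis j 1 :: real^'n) $ i = (if i = j then c else 0)" for i
    by (simp add: axis_def)
  then show ?thesis
    unfolding matrix_vector_mult_basis vec_eq_iff column_def by simp
qed

text \<open>\<open>X\<close> is an arbitrary real matrix. Eigenvectors of its exponential pass to
  \<open>X\<close>: left ones fix rows 1 and 2, a right one fixes column 3.\<close>

lemma mat_log_HH_unique:
  assumes T: "a > 0" "b > 0" "e > 0"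
    and X: "mat_exp X = low a b e c d" "\<And>l. mat_eigenvalue X l \<Longrightarrow> \<bar>Im l\<bar> < pi"
  shows "X = low (ln a) (ln b) (ln e) (c / exp_dq (ln a) (ln e)) (d / exp_dq (ln b) (ln e))"
proof -
  have row: "transpose X *v axis i 1 = ln m *\<^sub>R axis i 1"
    if "transpose (low a b e c d) *v axis i 1 = m *\<^sub>R axis i 1" "m > 0" for i m
    by (rule mat_exp_eigenvector_imp)
      (use that X in \<open>simp_all add: mat_exp_transpose mat_eigenvalue_transpose\<close>)
  have "transpose X *v axis 1 1 = ln a *\<^sub>R axis 1 1"
    by (rule row) (use T in \<open>simp_all add: matrix_column_eigen transpose_def forall_3\<close>)
  moreover have "transpose X *v axis 2 1 = ln b *\<^sub>R axis 2 1"
    by (rule row) (use T in \<open>simp_all add: matrix_column_eigen transpose_def forall_3\<close>)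
  moreover have "X *v axis 3 1 = ln e *\<^sub>R axis 3 1"
    by (rule mat_exp_eigenvector_imp) (use T X in \<open>simp_all add: matrix_column_eigen forall_3\<close>)
  ultimately have L: "X = low (ln a) (ln b) (ln e) (X $ 3 $ 1) (X $ 3 $ 2)"
    unfolding matrix_column_eigen by (simp add: vec_eq_iff transpose_def forall_3)
  \<comment> \<open>Only two entries of the last row are still unknown; the explicit exponential
    determines them.\<close>
  then have "low a b e c d = low a b e (X $ 3 $ 1 * exp_dq (ln a) (ln e)) (X $ 3 $ 2 * exp_dq (ln b) (ln e))"
    using X(1) mat_exp_low T by (metis exp_ln)
  then show ?thesis
    by (subst L) (simp add: low_eq_iff exp_dq_nonzero)
qed

lemma mat_log_unique_on_HH:
  assumes "T \<in> HH" and "mat_exp X = T" "\<And>l. mat_eigenvalue X l \<Longrightarrow> \<bar>Im l\<bar> < pi"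
  shows "mat_log T = X"
  unfolding mat_log_def
proof (rule the_equality)
  fix Y
  assume "mat_exp Y = T \<and> (\<forall>l. mat_eigenvalue Y l \<longrightarrow> \<bar>Im l\<bar> < pi)"
  then show "Y = X"
    using assms mat_log_HH_unique unfolding HH_iff by metis
qed (use assms in auto)

lemma mat_log_HH:
  assumes "T \<in> HH"
  shows "\<exists>p q w r s. mat_log T = low p q w r s" "mat_exp (mat_log T) = T"
    "mat_eigenvalue (mat_log T) l \<Longrightarrow> \<bar>Im l\<bar> < pi"
proof -
  obtain a b e c d where T: "T = low a b e c d" "a > 0" "b > 0" "e > 0"
    using assms HH_iff by auto
  \<comment> \<open>Obtained by inverting \<open>mat_exp_low\<close> entry by entry.\<close>
  define L where "L = low (ln a) (ln b) (ln e) (c / exp_dq (ln a) (ln e)) (d / exp_dq (ln b) (ln e))"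
  have L: "mat_exp L = T" "\<And>l. mat_eigenvalue L l \<Longrightarrow> \<bar>Im l\<bar> < pi"
    using T by (auto simp: L_def mat_exp_low exp_dq_nonzero dest: mat_eigenvalue_low)
  have eq: "mat_log T = L"
    using mat_log_unique_on_HH assms L by blast
  show "\<exists>p q w r s. mat_log T = low p q w r s"
    using eq L_def by blast
  show "mat_exp (mat_log T) = T" "mat_eigenvalue (mat_log T) l \<Longrightarrow> \<bar>Im l\<bar> < pi"
    using eq L by auto
qed

section \<open>Real powers on the Cholesky group\<close>

lemma mat_rpow_HH: "T \<in> HH \<Longrightarrow> mat_rpow T t \<in> HH"
  using mat_log_HH(1)[of T] by (auto simp: mat_rpow_def scaleR_low mat_exp_low)

lemma mat_rpow_add: "T \<in> HH \<Longrightarrow> mat_rpow T a ** mat_rpow T b = mat_rpow T (a + b)"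
  using mat_log_HH(1)[of T] by (auto simp: mat_rpow_def mat_exp_scaleR_low_add)

lemma mat_rpow_one: "T \<in> HH \<Longrightarrow> mat_rpow T 1 = T"
  by (simp add: mat_rpow_def mat_log_HH)

lemma mat_rpow_zero: "mat_rpow (T :: real^3^3) 0 = mat 1"
proof -
  have "0 *\<^sub>R mat_log T = low 0 0 0 0 0"
    by (simp add: vec_eq_iff forall_3)
  then show ?thesis
    unfolding mat_rpow_def by (simp only: mat_exp_low) (simp add: low_one)
qed

lemma HH_mult: "S \<in> HH \<Longrightarrow> T \<in> HH \<Longrightarrow> S ** T \<in> HH"
  unfolding HH_iff[of S] HH_iff[of T] by (auto simp: low_mult)

text \<open>The conjugated logarithm exponentiates to the conjugated matrix and keeps its
  eigenvalues in the strip, so uniqueness makes it the principal one.\<close>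

lemma mat_rpow_conj:
  assumes "T \<in> HH" "P \<in> HH" "Q \<in> HH" and PQ: "P ** Q = mat 1"
  shows "mat_rpow (Q ** T ** P) t = Q ** mat_rpow T t ** P"
proof -
  have "mat_log (Q ** T ** P) = Q ** mat_log T ** P"
  proof (rule mat_log_unique_on_HH)
    show "Q ** T ** P \<in> HH"
      using assms HH_mult by blast
    show "mat_exp (Q ** mat_log T ** P) = Q ** T ** P"
      using mat_exp_conj[OF PQ] mat_log_HH(2) assms(1) by metis
    show "\<bar>Im l\<bar> < pi" if "mat_eigenvalue (Q ** mat_log T ** P) l" for l
      using mat_eigenvalue_conj[OF PQ that] mat_log_HH(3) assms(1) by blast
  qed
  moreover have "t *\<^sub>R (Q ** mat_log T ** P) = Q ** (t *\<^sub>R mat_log T) ** P"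
    by (simp add: linear_cmul[OF bounded_linear.linear[OF bounded_linear_matrix_mult_left]]
      linear_cmul[OF bounded_linear.linear[OF bounded_linear_matrix_mult_right]])
  ultimately show ?thesis
    by (simp add: mat_rpow_def mat_exp_conj[OF PQ])
qed

section \<open>Geometric means and the Cholesky factor\<close>

lemma H_wmean_eq:
  assumes "A \<in> HH" "B \<in> HH"
  shows "H_wmean A t B = A ** mat_rpow (matrix_inv A ** B) t"
proof -
  define P where "P = mat_rpow A (1/2)"
  define Q where "Q = mat_rpow A (-1/2)"
  have PQ: "P \<in> HH" "Q \<in> HH" "P ** P = A" "P ** Q = mat 1" "Q ** P = mat 1"
    using assms by (simp_all add: P_def Q_def mat_rpow_HH mat_rpow_add mat_rpow_one mat_rpow_zero)
  have QQ: "A ** (Q ** Q) = mat 1"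
    by (metis PQ(3,4) matrix_mul_assoc matrix_mul_rid)
  \<comment> \<open>\<open>matrix_inv\<close> is a choice among two-sided inverses, so one is
    exhibited before the choice is evaluated.\<close>
  then have "\<exists>A'. A ** A' = mat 1 \<and> A' ** A = mat 1"
    using matrix_left_right_inverse by blast
  then have "matrix_inv A ** A = mat 1"
    unfolding matrix_inv_def by (rule someI2_ex) blast
  then have inv: "matrix_inv A = Q ** Q"
    by (metis QQ matrix_mul_assoc matrix_mul_lid matrix_mul_rid)
  \<comment> \<open>The inverse of \<open>A\<close> is QQ and QP = 1, so QQB is the conjugate
    Q(QBQ)P.\<close>
  have "mat_rpow (matrix_inv A ** B) t = mat_rpow (Q ** (Q ** B ** Q) ** P) t"
    by (metis PQ(5) inv matrix_mul_assoc matrix_mul_rid)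
  also have "\<dots> = Q ** mat_rpow (Q ** B ** Q) t ** P"
    using PQ assms HH_mult by (intro mat_rpow_conj) blast+
  finally have "A ** mat_rpow (matrix_inv A ** B) t = P ** (P ** Q) ** mat_rpow (Q ** B ** Q) t ** P"
    using PQ(3) by (simp add: matrix_mul_assoc)
  then show ?thesis
    unfolding H_wmean_def PQ(4) P_def[symmetric] Q_def[symmetric] by simp
qed

text \<open>An explicit Cholesky factorisation; it places the chosen preimage \<open>chol x\<close>
  in \<open>HH\<close>.\<close>

lemma Omega_subset_Phi_image: "Omega \<subseteq> Phi ` HH"
proof
  fix x
  assume x: "x \<in> Omega"
  have sym: "x $ 1 $ 2 = 0" "x $ 2 $ 1 = 0" "x $ 1 $ 3 = x $ 3 $ 1" "x $ 2 $ 3 = x $ 3 $ 2"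
    using x by (auto simp: Omega_def VV_def transpose_def vec_eq_iff)
  \<comment> \<open>The choice \<open>(- r / \<alpha>, - s / \<beta>, 1)\<close> below yields positivity of the Schur complement,
    the square of the last diagonal entry of the factor.\<close>
  have quad: "x $ 1 $ 1 * (u * u) + x $ 2 $ 2 * (v * v) + x $ 3 $ 3 * (w * w)
      + 2 * x $ 3 $ 1 * u * w + 2 * x $ 3 $ 2 * v * w > 0"
    if "u \<noteq> 0 \<or> v \<noteq> 0 \<or> w \<noteq> 0" for u v w
  proof -
    let ?v = "vector [u, v, w] :: real^3"
    have "?v \<noteq> 0"
      using that by (auto simp: vec_eq_iff forall_3 vector_3)
    then have "?v \<bullet> (x *v ?v) > 0"
      using x by (simp add: Omega_def)
    then show ?thesis
      by (simp add: inner_vec_def matrix_vector_mult_def sum_3 vector_3 sym algebra_simps)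
  qed
  define \<alpha> \<beta> \<gamma> r s where "\<alpha> = x $ 1 $ 1" and "\<beta> = x $ 2 $ 2" and "\<gamma> = x $ 3 $ 3"
    and "r = x $ 3 $ 1" and "s = x $ 3 $ 2"
  note defs = \<alpha>_def \<beta>_def \<gamma>_def r_def s_def
  have pos: "\<alpha> > 0" "\<beta> > 0"
    using quad[of 1 0 0] quad[of 0 1 0] by (auto simp: defs)
  have "\<alpha> * (r / \<alpha> * (r / \<alpha>)) + \<beta> * (s / \<beta> * (s / \<beta>)) + \<gamma> - 2 * r * (r / \<alpha>) - 2 * s * (s / \<beta>) > 0"
    using quad[of "- r / \<alpha>" "- s / \<beta>" 1] by (simp add: defs)
  then have schur: "\<gamma> - r\<^sup>2 / \<alpha> - s\<^sup>2 / \<beta> > 0"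
    using pos by (simp add: power2_eq_square)
  \<comment> \<open>Solves Phi(T) = x: the first two diagonal entries are roots, the products with
    them must give r and s, and the Schur complement is left for the last diagonal entry.\<close>
  define T where "T = low (sqrt \<alpha>) (sqrt \<beta>) (sqrt (\<gamma> - r\<^sup>2 / \<alpha> - s\<^sup>2 / \<beta>)) (r / sqrt \<alpha>) (s / sqrt \<beta>)"
  have "T \<in> HH"
    unfolding HH_iff T_def using pos schur by (intro exI conjI) (rule refl, auto)
  moreover have "Phi T = x"
  proof -
    have "r / sqrt \<alpha> * (r / sqrt \<alpha>) + s / sqrt \<beta> * (s / sqrt \<beta>) + (\<gamma> - r\<^sup>2 / \<alpha> - s\<^sup>2 / \<beta>) = \<gamma>"
      using pos by (simp add: power2_eq_square)
    then show ?thesis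
      using pos schur sym
      by (simp add: Phi_def T_def vec_eq_iff forall_3 matrix_matrix_mult_def transpose_def sum_3
          flip: defs)
  qed
  ultimately show "x \<in> Phi ` HH"
    by blast
qed

theorem corollary4p3:
  fixes x y :: "real^3^3"
  assumes "x \<in> Omega" and "y \<in> Omega"
  shows "(\<forall>t\<in>{0..1}. cv_path x y t = Phi (H_wmean (chol x) t (chol y))) \<and>
         cv_mean x y = Phi (H_mean (chol x) (chol y))"
proof -
  have "chol x \<in> HH" "chol y \<in> HH"
    using assms Omega_subset_Phi_image by (auto simp: chol_def intro!: inv_into_into)
  then have "cv_path x y t = Phi (H_wmean (chol x) t (chol y))" for t
    by (simp add: cv_path_def H_wmean_eq)
  then show ?thesis
    by (simp add: cv_mean_def H_mean_def)
qed

end
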